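(* Let $L$ be a Markov operator acting on two normed vector spaces $(B_s,\|\cdot\|_s)$, $(B_w,\|\cdot\|_w)$ with $B_s\subseteq B_w\subseteq CM(X)$ and $\|\cdot\|_s\ge\|\cdot\|_w$ on $B_s$. Suppose: (1) (Lasota--Yorke inequality) there are $A,B\ge0$ and $0\le\lambda_1<1$ such that for each $g\in B_s$ and each $n$, $\|L^ng\|_s\le A\lambda_1^n\|g\|_s+B\|g\|_w$; (2) (Convergence to equilibrium) for each $g\in V_s$, $\lim_{n\to\infty}\|L^ng\|_w=0$; (3) (Compact inclusion) the strong zero average space $V_s$ is compactly immersed in the weak one $V_w$: for each $\epsilon>0$ the unit ball of $(V_s,\|\cdot\|_s)$ has a finite $\epsilon$-net for the norm $\|\cdot\|_w$; (4) (Weak boundedness) the weak operator norm of $L$ restricted to $V_s$ satisfies $\sup_n\|L^n|_{V_s}\|_w<\infty$. Then there are $C_2>0$ and $\rho_2<1$ such that for all $g\in V_s$ and all $n$ $$\|L^ng\|_s\le C_2\rho_2^n\|g\|_s.$$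
   Context: $X$ is a metric space and $CM(X)$ is the set of Borel complex valued measures on $X$. A Markov operator is a linear operator that maps positive measures to positive measures and satisfies $[L\mu](X)=\mu(X)$ for each $\mu$. $L$ acts on both spaces: $L(B_s)\subseteq B_s$, $L(B_w)\subseteq B_w$. $V_s=\{g\in B_s: g(X)=0\}$ and $V_w=\{g\in B_w: g(X)=0\}$. In (4), $\|L^n|_{V_s}\|_w=\sup\{\|L^ng\|_w: g\in V_s,\|g\|_w\le1\}$. *)

theory Defs
  imports "HOL-Analysis.Analysis"
begin

(* Set functions are total, so a complex measure is normalised to vanish off the Borel sets; this
   makes equality of measures coincide with equality on Borel sets. Countable additivity is required
   for every disjoint sequence, hence the series converges in every order and therefore absolutely;
   the constant sequence {} gives value 0 on the empty set. *)
typedef (overloaded) 'a complex_measure =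
  "{\<mu> :: 'a::metric_space set \<Rightarrow> complex.
      (\<forall>A. A \<notin> sets borel \<longrightarrow> \<mu> A = 0) \<and>
      (\<forall>A :: nat \<Rightarrow> 'a set. range A \<subseteq> sets borel \<longrightarrow> disjoint_family A \<longrightarrow>
         (\<lambda>i. \<mu> (A i)) sums \<mu> (\<Union>i. A i))}"
  morphisms cmeasure Abs_complex_measure
  by (rule exI[of _ "\<lambda>_. 0"]) simp

setup_lifting type_definition_complex_measure

instantiation complex_measure :: (metric_space) ab_group_add
begin

lift_definition zero_complex_measure :: "'a complex_measure" is "\<lambda>_. 0"
  by simp

lift_definition plus_complex_measure ::
    "'a complex_measure \<Rightarrow> 'a complex_measure \<Rightarrow> 'a complex_measure"
  is "\<lambda>\<mu> \<nu> A. \<mu> A + \<nu> A"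
  by (simp add: sums_add)

lift_definition uminus_complex_measure :: "'a complex_measure \<Rightarrow> 'a complex_measure"
  is "\<lambda>\<mu> A. - \<mu> A"
  by (simp add: sums_minus)

lift_definition minus_complex_measure ::
    "'a complex_measure \<Rightarrow> 'a complex_measure \<Rightarrow> 'a complex_measure"
  is "\<lambda>\<mu> \<nu> A. \<mu> A - \<nu> A"
  by (simp add: sums_diff)

instance
  by standard (transfer; simp add: fun_eq_iff algebra_simps)+

end

lift_definition scale_cm ::
    "complex \<Rightarrow> 'a::metric_space complex_measure \<Rightarrow> 'a complex_measure"  (infixr "*\<^sub>C" 75)
  is "\<lambda>c \<mu> A. c * \<mu> A"
  by (simp add: sums_mult)

global_interpretation cm: vector_space "scale_cm :: complex \<Rightarrow> 'a::metric_space complex_measure \<Rightarrow> _"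
  by standard (transfer; simp add: fun_eq_iff algebra_simps)+

definition positive_cm :: "'a::metric_space complex_measure \<Rightarrow> bool" where
  "positive_cm \<mu> \<longleftrightarrow> (\<forall>A \<in> sets borel. cmeasure \<mu> A \<in> \<real>\<^sub>\<ge>\<^sub>0)"

definition normed_subspace ::
    "'a::metric_space complex_measure set \<Rightarrow> ('a complex_measure \<Rightarrow> real) \<Rightarrow> bool" where
  "normed_subspace V N \<longleftrightarrow>
     cm.subspace V \<and>
     (\<forall>\<mu>\<in>V. N \<mu> \<ge> 0) \<and>
     (\<forall>\<mu>\<in>V. N \<mu> = 0 \<longleftrightarrow> \<mu> = 0) \<and>
     (\<forall>c. \<forall>\<mu>\<in>V. N (c *\<^sub>C \<mu>) = cmod c * N \<mu>) \<and>
     (\<forall>\<mu>\<in>V. \<forall>\<nu>\<in>V. N (\<mu> + \<nu>) \<le> N \<mu> + N \<nu>)"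

(* L is constrained only on V, so it models an operator whose domain is V. *)
definition markov_operator_on ::
    "'a::metric_space complex_measure set \<Rightarrow> ('a complex_measure \<Rightarrow> 'a complex_measure) \<Rightarrow> bool" where
  "markov_operator_on V L \<longleftrightarrow>
     (\<forall>\<mu>\<in>V. \<forall>\<nu>\<in>V. L (\<mu> + \<nu>) = L \<mu> + L \<nu>) \<and>
     (\<forall>c. \<forall>\<mu>\<in>V. L (c *\<^sub>C \<mu>) = c *\<^sub>C L \<mu>) \<and>
     (\<forall>\<mu>\<in>V. positive_cm \<mu> \<longrightarrow> positive_cm (L \<mu>)) \<and>
     (\<forall>\<mu>\<in>V. cmeasure (L \<mu>) UNIV = cmeasure \<mu> UNIV)"

definition zero_average ::
    "'a::metric_space complex_measure set \<Rightarrow> 'a complex_measure set" where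
  "zero_average V = {\<mu>\<in>V. cmeasure \<mu> UNIV = 0}"

(* The net may consist of arbitrary points of W; as the condition ranges over all \<epsilon>, requiring the
   net to lie in the unit ball itself would be equivalent when the inclusion V \<subseteq> W is linear. *)
definition compactly_immersed ::
    "'a::metric_space complex_measure set \<Rightarrow> ('a complex_measure \<Rightarrow> real) \<Rightarrow>
     'a complex_measure set \<Rightarrow> ('a complex_measure \<Rightarrow> real) \<Rightarrow> bool" where
  "compactly_immersed V N\<^sub>V W N\<^sub>W \<longleftrightarrow>
     V \<subseteq> W \<and>
     (\<forall>\<epsilon>>0. \<exists>F. finite F \<and> F \<subseteq> W \<and>
        (\<forall>g\<in>V. N\<^sub>V g \<le> 1 \<longrightarrow> (\<exists>f\<in>F. N\<^sub>W (g - f) \<le> \<epsilon>)))"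

(* Values in ereal, so that the supremum of an unbounded set is \<infinity> and not a junk value. *)
definition opnorm_on ::
    "'a::metric_space complex_measure set \<Rightarrow> ('a complex_measure \<Rightarrow> real) \<Rightarrow>
     ('a complex_measure \<Rightarrow> 'a complex_measure) \<Rightarrow> ereal" where
  "opnorm_on V N T = (SUP g\<in>{g\<in>V. N g \<le> 1}. ereal (N (T g)))"

end

theory Submission
  imports Defs
begin

text \<open>
  On the zero-average space $V_s$ some power of $L$ contracts the strong norm by a factor $1/2$,
  and this suffices: all powers are bounded there by the Lasota--Yorke inequality, so splitting
  $n = qK + r$ turns one contracting power $L^K$ into exponential decay.

  To find $K$, use the Lasota--Yorke inequality twice, along $n + m$ steps. For $g \<in> V_s$,
  \[ \|L^{n+m} g\|_s \<le> A \lambda_1^m \|L^n g\|_s + B \|L^n g\|_w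
       \<le> A (A + B) \lambda_1^m \|g\|_s + B \|L^n g\|_w . \]
  The first term is small once $m$ is large. For the second one needs
  $\|L^n g\|_w \<le> \delta \|g\|_s$ with $n$ independent of $g$, whereas convergence to
  equilibrium gives an $n$ for each $g$ separately. Compactness closes this gap: weak boundedness
  makes the maps $L^n$ equicontinuous for the weak norm on $V_s$, and an equicontinuous sequence
  that converges pointwise converges uniformly on the totally bounded strong unit ball
  (\<open>uniform_decay_on_unit_ball\<close>). The remaining ingredients are the estimate
  \<open>lasota_yorke_two_step\<close> and the iteration argument \<open>exponential_decay_from_contracting_power\<close>.
\<close>

section \<open>Normed spaces of measures and their zero-average parts\<close>

lemma normed_subspaceD:
  assumes "normed_subspace V N"
  shows normed_subspace_subspace: "cm.subspace V"
    and normed_subspace_norm_nonneg: "g \<in> V \<Longrightarrow> 0 \<le> N g"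
    and normed_subspace_norm_scale: "g \<in> V \<Longrightarrow> N (c *\<^sub>C g) = cmod c * N g"
  using assms by (simp_all add: normed_subspace_def)

lemma normed_subspace_subset:
  assumes W: "normed_subspace W N" and "cm.subspace V" and VW: "V \<subseteq> W"
  shows "normed_subspace V N"
proof -
  have "g \<in> W" if "g \<in> V" for g
    using VW that by blast
  with assms(1,2) show ?thesis
    unfolding normed_subspace_def by simp
qed

lemma normed_subspace_norm_minus_commute:
  assumes "normed_subspace V N" "g \<in> V" "h \<in> V"
  shows "N (g - h) = N (h - g)"
proof -
  have "g - h \<in> V"
    using assms unfolding normed_subspace_def by (simp add: cm.subspace_diff)
  then have "N ((-1) *\<^sub>C (g - h)) = cmod (-1) * N (g - h)"
    using assms unfolding normed_subspace_def by blast
  then show ?thesis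
    by simp
qed

lemma normed_subspace_triangle_diff:
  assumes "normed_subspace V N" "f \<in> V" "g \<in> V" "h \<in> V"
  shows "N (f - h) \<le> N (f - g) + N (g - h)"
proof -
  have "f - g \<in> V" "g - h \<in> V"
    using assms unfolding normed_subspace_def by (simp_all add: cm.subspace_diff)
  then have "N ((f - g) + (g - h)) \<le> N (f - g) + N (g - h)"
    using assms unfolding normed_subspace_def by blast
  then show ?thesis
    by simp
qed

lemma normed_subspace_zero_average:
  assumes "normed_subspace V N"
  shows "normed_subspace (zero_average V) N"
proof -
  have "cm.subspace (zero_average V)"
    using assms unfolding normed_subspace_def zero_average_def
    by (intro cm.subspaceI)
      (auto simp: cm.subspace_0 cm.subspace_add cm.subspace_scale
        zero_complex_measure.rep_eq plus_complex_measure.rep_eq scale_cm.rep_eq)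
  then show ?thesis
    by (rule normed_subspace_subset[OF assms]) (auto simp: zero_average_def)
qed

lemma funpow_image_subset:
  assumes "f ` V \<subseteq> V"
  shows "(f ^^ n) ` V \<subseteq> V"
  using assms by (induction n) auto

lemma markov_operator_on_funpow:
  assumes "markov_operator_on V L" "L ` V \<subseteq> V"
  shows "markov_operator_on V (L ^^ n)"
proof (induction n)
  case 0
  show ?case
    by (simp add: markov_operator_on_def)
next
  case (Suc n)
  have "(L ^^ n) \<mu> \<in> V" if "\<mu> \<in> V" for \<mu>
    using funpow_image_subset[OF assms(2)] that by blast
  then show ?case
    using Suc.IH assms(1) unfolding markov_operator_on_def by simp
qed

lemma markov_operator_on_diff:
  assumes "markov_operator_on V L" "cm.subspace V" "g \<in> V" "h \<in> V"
  shows "L (g - h) = L g - L h"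
proof -
  have "L ((g - h) + h) = L (g - h) + L h"
    using assms cm.subspace_diff unfolding markov_operator_on_def by blast
  then show ?thesis
    by simp
qed

section \<open>Bounded and uniformly decaying families of operators\<close>

lemma normed_subspace_bound_from_unit_ball:
  assumes V: "normed_subspace V N"
    and p_hom: "\<And>c g. g \<in> V \<Longrightarrow> p (c *\<^sub>C g) = cmod c * p g"
    and unit_ball: "\<And>g. g \<in> V \<Longrightarrow> N g \<le> 1 \<Longrightarrow> p g \<le> M"
    and g: "g \<in> V"
  shows "p g \<le> M * N g"
proof (cases "g = 0")
  case True
  have "p 0 = 0"
    using p_hom[OF g, of 0] by simp
  moreover have "N g = 0"
    using V g True unfolding normed_subspace_def by blast
  ultimately show ?thesis
    using True by simp
next
  case False
  then have pos: "N g > 0"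
    using V g unfolding normed_subspace_def by (metis less_eq_real_def)
  define c where "c = complex_of_real (1 / N g)"
  have c: "cmod c = 1 / N g"
    unfolding c_def norm_of_real using pos by simp
  have "c *\<^sub>C g \<in> V"
    using V g cm.subspace_scale unfolding normed_subspace_def by blast
  moreover have "N (c *\<^sub>C g) = cmod c * N g"
    using V g unfolding normed_subspace_def by blast
  ultimately have "p (c *\<^sub>C g) \<le> M"
    using unit_ball c pos by simp
  then have "p g / N g \<le> M"
    using p_hom[OF g, of c] c by simp
  then show ?thesis
    using pos by (simp add: divide_le_eq)
qed

text \<open>
  The usual argument that an equicontinuous family converging pointwise converges uniformly on a
  totally bounded set. The net supplied by compactness may lie outside \<open>V\<close>, where nothing is
  known about convergence or boundedness; therefore each net point close to the unit ball is first
  replaced by a nearby point of \<open>V\<close>, at the price of doubling the radius.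
\<close>

lemma uniform_decay_on_unit_ball:
  fixes T :: "nat \<Rightarrow> 'a::metric_space complex_measure \<Rightarrow> 'a complex_measure"
  assumes W: "normed_subspace W N\<^sub>W"
    and V: "cm.subspace V"
    and compact: "compactly_immersed V N\<^sub>V W N\<^sub>W"
    and T_maps: "\<And>n g. g \<in> V \<Longrightarrow> T n g \<in> V"
    and T_diff: "\<And>n g h. g \<in> V \<Longrightarrow> h \<in> V \<Longrightarrow> T n (g - h) = T n g - T n h"
    and T_bounded: "\<And>n g. g \<in> V \<Longrightarrow> N\<^sub>W (T n g) \<le> M * N\<^sub>W g"
    and T_converges: "\<And>g. g \<in> V \<Longrightarrow> (\<lambda>n. N\<^sub>W (T n g)) \<longlonglongrightarrow> 0"
    and "\<delta> > 0"
  shows "\<forall>\<^sub>F n in sequentially. \<forall>g\<in>V. N\<^sub>V g \<le> 1 \<longrightarrow> N\<^sub>W (T n g) \<le> \<delta>"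
proof -
  have VW: "V \<subseteq> W"
    using compact by (simp add: compactly_immersed_def)
  \<comment> \<open>Two points near one net point are $2\varepsilon$-close; by linearity their images under
    any $T_n$ then differ by at most $2\varepsilon |M| \<le> \delta/2$.\<close>
  define \<epsilon> where "\<epsilon> = \<delta> / (4 * (\<bar>M\<bar> + 1))"
  have \<epsilon>: "\<epsilon> > 0" "\<bar>M\<bar> * (2 * \<epsilon>) \<le> \<delta> / 2"
    using \<open>\<delta> > 0\<close> unfolding \<epsilon>_def by (simp_all add: field_simps)
  obtain F where F: "finite F" "F \<subseteq> W"
    and net: "\<And>g. g \<in> V \<Longrightarrow> N\<^sub>V g \<le> 1 \<Longrightarrow> \<exists>f\<in>F. N\<^sub>W (g - f) \<le> \<epsilon>"
    using compact \<epsilon>(1) unfolding compactly_immersed_def by meson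
  define near where "near f h \<longleftrightarrow> h \<in> V \<and> N\<^sub>W (h - f) \<le> \<epsilon>" for f h
  define G where "G = {f \<in> F. \<exists>h. near f h}"
  define centre where "centre f = (SOME h. near f h)" for f
  have near_centre: "near f (centre f)" if "f \<in> G" for f
    using that unfolding G_def centre_def by (auto intro: someI)
  have "\<forall>\<^sub>F n in sequentially. N\<^sub>W (T n (centre f)) < \<delta> / 2" if "f \<in> G" for f
  proof (rule order_tendstoD(2)[OF T_converges])
    show "centre f \<in> V"
      using near_centre[OF that] by (simp add: near_def)
  qed (use \<open>\<delta> > 0\<close> in simp)
  moreover have "finite G"
    using F(1) by (simp add: G_def)
  ultimately have "\<forall>\<^sub>F n in sequentially. \<forall>f\<in>G. N\<^sub>W (T n (centre f)) < \<delta> / 2"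
    by (simp add: eventually_ball_finite)
  then show ?thesis
  proof eventually_elim
    case (elim n)
    show ?case
    proof (intro ballI impI)
      fix g assume g: "g \<in> V" "N\<^sub>V g \<le> 1"
      obtain f where f: "f \<in> F" "N\<^sub>W (g - f) \<le> \<epsilon>"
        using net[OF g] by blast
      then have "f \<in> G"
        using g(1) unfolding G_def near_def by blast
      define h where "h = centre f"
      have h: "h \<in> V" "N\<^sub>W (h - f) \<le> \<epsilon>"
        using near_centre[OF \<open>f \<in> G\<close>] unfolding near_def h_def by simp_all
      have in_W: "g \<in> W" "h \<in> W" "f \<in> W"
        using g(1) h(1) f(1) VW F(2) by auto
      have gh: "g - h \<in> V"
        using V g(1) h(1) by (simp add: cm.subspace_diff)
      have "N\<^sub>W (g - h) \<le> N\<^sub>W (g - f) + N\<^sub>W (f - h)"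
        using normed_subspace_triangle_diff[OF W] in_W by blast
      then have close: "N\<^sub>W (g - h) \<le> 2 * \<epsilon>"
        using f(2) h(2) normed_subspace_norm_minus_commute[OF W in_W(3,2)] by linarith
      have "N\<^sub>W (g - h) \<ge> 0"
        using normed_subspace_norm_nonneg[OF W] gh VW by blast
      then have "M * N\<^sub>W (g - h) \<le> \<bar>M\<bar> * (2 * \<epsilon>)"
        using close by (intro mult_mono) auto
      then have diff_small: "N\<^sub>W (T n (g - h)) \<le> \<delta> / 2"
        using T_bounded[OF gh, of n] \<epsilon>(2) by linarith
      have "T n (g - h) \<in> W" "T n h \<in> W"
        using T_maps gh h(1) VW by blast+
      then have "N\<^sub>W (T n (g - h) + T n h) \<le> N\<^sub>W (T n (g - h)) + N\<^sub>W (T n h)"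
        using W unfolding normed_subspace_def by blast
      moreover have "T n (g - h) + T n h = T n g"
        using T_diff[OF g(1) h(1)] by simp
      moreover have "N\<^sub>W (T n h) < \<delta> / 2"
        using elim \<open>f \<in> G\<close> unfolding h_def by blast
      ultimately show "N\<^sub>W (T n g) \<le> \<delta>"
        using diff_small by simp
    qed
  qed
qed

section \<open>From the Lasota--Yorke inequality to exponential decay\<close>

text \<open>
  Applying the inequality to $L^n g$ for $m$ steps makes the weak norm appear at time $n$, where it
  has already decayed; applying it to $g$ itself only yields the crude bound
  $\|L^n g\|_s \<le> (A + B) \|g\|_s$, which the factor $\lambda^m$ then absorbs.
\<close>

lemma lasota_yorke_two_step:
  fixes p q :: "'v \<Rightarrow> real"
  assumes constants: "0 \<le> A" "0 \<le> B" "0 \<le> l" "l \<le> 1"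
    and nonneg: "\<And>g. g \<in> V \<Longrightarrow> 0 \<le> p g"
    and dominated: "\<And>g. g \<in> V \<Longrightarrow> q g \<le> p g"
    and invariant: "L ` V \<subseteq> V"
    and lasota_yorke: "\<And>g n. g \<in> V \<Longrightarrow> p ((L ^^ n) g) \<le> A * l ^ n * p g + B * q g"
    and g: "g \<in> V"
  shows "p ((L ^^ n) g) \<le> (A + B) * p g"
    and "p ((L ^^ (m + n)) g) \<le> A * (A + B) * l ^ m * p g + B * q ((L ^^ n) g)"
proof -
  have "A * l ^ n * p g \<le> A * 1 * p g"
    using constants nonneg[OF g] by (intro mult_mono) (auto simp: power_le_one)
  moreover have "B * q g \<le> B * p g"
    using constants dominated[OF g] by (intro mult_left_mono)
  ultimately show crude: "p ((L ^^ n) g) \<le> (A + B) * p g"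
    using lasota_yorke[OF g, of n] by (simp add: algebra_simps)
  have "(L ^^ n) g \<in> V"
    using funpow_image_subset[OF invariant] g by blast
  then have "p ((L ^^ m) ((L ^^ n) g)) \<le> A * l ^ m * p ((L ^^ n) g) + B * q ((L ^^ n) g)"
    by (rule lasota_yorke)
  moreover have "A * l ^ m * p ((L ^^ n) g) \<le> A * l ^ m * ((A + B) * p g)"
    using constants crude by (intro mult_left_mono) auto
  ultimately show "p ((L ^^ (m + n)) g) \<le> A * (A + B) * l ^ m * p g + B * q ((L ^^ n) g)"
    by (simp add: funpow_add algebra_simps)
qed

text \<open>
  Write $n = qK + r$ with $r < K$ and let $\rho$ be the $K$-th root of $\theta$: the $q$ full
  blocks contribute $\theta^q = \rho^{qK}$ and the remainder at most $D$. Replacing $\rho^{qK}$ by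
  $\rho^n$ loses a factor $\rho^{-r} \<le> \theta^{-1}$, which explains the constant $D / \theta$.
\<close>

lemma exponential_decay_from_contracting_power:
  fixes p :: "'v \<Rightarrow> real"
  assumes "K > 0" "0 < \<theta>" "\<theta> < 1" "0 \<le> D"
    and nonneg: "\<And>g. g \<in> V \<Longrightarrow> 0 \<le> p g"
    and invariant: "L ` V \<subseteq> V"
    and bounded: "\<And>g n. g \<in> V \<Longrightarrow> p ((L ^^ n) g) \<le> D * p g"
    and contracting: "\<And>g. g \<in> V \<Longrightarrow> p ((L ^^ K) g) \<le> \<theta> * p g"
  shows "\<exists>\<rho>. 0 < \<rho> \<and> \<rho> < 1 \<and> (\<forall>g\<in>V. \<forall>n. p ((L ^^ n) g) \<le> D / \<theta> * \<rho> ^ n * p g)"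
proof -
  define \<rho> where "\<rho> = root K \<theta>"
  have \<rho>: "0 < \<rho>" "\<rho> < 1" "\<rho> ^ K = \<theta>"
    using assms(1-3) unfolding \<rho>_def by simp_all
  have blocks: "p ((L ^^ (q * K)) g) \<le> \<theta> ^ q * p g" if "g \<in> V" for g q
  proof (induction q)
    case (Suc q)
    have "(L ^^ (q * K)) g \<in> V"
      using funpow_image_subset[OF invariant] that by blast
    then have "p ((L ^^ K) ((L ^^ (q * K)) g)) \<le> \<theta> * p ((L ^^ (q * K)) g)"
      by (rule contracting)
    also have "\<dots> \<le> \<theta> * (\<theta> ^ q * p g)"
      using Suc.IH assms(2) by (intro mult_left_mono) auto
    finally show ?case
      by (simp add: funpow_add)
  qed simp
  have "p ((L ^^ n) g) \<le> D / \<theta> * \<rho> ^ n * p g" if g: "g \<in> V" for g n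
  proof -
    define q r where "q = n div K" and "r = n mod K"
    have n: "n = r + q * K" and "r \<le> K"
      using assms(1) by (simp_all add: q_def r_def less_imp_le)
    have "(L ^^ (q * K)) g \<in> V"
      using funpow_image_subset[OF invariant] g by blast
    then have "p ((L ^^ r) ((L ^^ (q * K)) g)) \<le> D * p ((L ^^ (q * K)) g)"
      by (rule bounded)
    also have "\<dots> \<le> D * (\<theta> ^ q * p g)"
      using blocks[OF g] assms(4) by (intro mult_left_mono)
    also have "\<dots> \<le> D * (\<rho> ^ n / \<theta> * p g)"
    proof (intro mult_left_mono mult_right_mono nonneg g assms(4))
      have "\<theta> \<le> \<rho> ^ r"
        using \<rho> \<open>r \<le> K\<close> power_decreasing[of r K \<rho>] by simp
      then have "\<theta> ^ q * \<theta> \<le> \<theta> ^ q * \<rho> ^ r"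
        using assms(2) by (intro mult_left_mono) auto
      also have "\<dots> = \<rho> ^ n"
        unfolding n \<rho>(3)[symmetric] by (simp add: power_add power_mult mult.commute)
      finally show "\<theta> ^ q \<le> \<rho> ^ n / \<theta>"
        using assms(2) by (simp add: le_divide_eq)
    qed
    finally show ?thesis
      by (simp add: n funpow_add)
  qed
  with \<rho> show ?thesis
    by blast
qed

theorem theorem30:
  fixes L :: "'a::metric_space complex_measure \<Rightarrow> 'a complex_measure"
    and B\<^sub>s B\<^sub>w :: "'a complex_measure set"
    and norm\<^sub>s norm\<^sub>w :: "'a complex_measure \<Rightarrow> real"
    and A B lambda\<^sub>1 :: real
  assumes strong_space: "normed_subspace B\<^sub>s norm\<^sub>s"
    and weak_space: "normed_subspace B\<^sub>w norm\<^sub>w"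
    and inclusion: "B\<^sub>s \<subseteq> B\<^sub>w"
    and norm_dominance: "\<forall>g\<in>B\<^sub>s. norm\<^sub>w g \<le> norm\<^sub>s g"
    and markov: "markov_operator_on B\<^sub>w L"
    and acts_strong: "L ` B\<^sub>s \<subseteq> B\<^sub>s"
    and acts_weak: "L ` B\<^sub>w \<subseteq> B\<^sub>w"
    and constants: "0 \<le> A" "0 \<le> B" "0 \<le> lambda\<^sub>1" "lambda\<^sub>1 < 1"
    and lasota_yorke: "\<forall>g\<in>B\<^sub>s. \<forall>n::nat. norm\<^sub>s ((L ^^ n) g) \<le> A * lambda\<^sub>1 ^ n * norm\<^sub>s g + B * norm\<^sub>w g"
    and convergence: "\<forall>g\<in>zero_average B\<^sub>s. (\<lambda>n. norm\<^sub>w ((L ^^ n) g)) \<longlonglongrightarrow> 0"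
    and compact_inclusion:
      "compactly_immersed (zero_average B\<^sub>s) norm\<^sub>s (zero_average B\<^sub>w) norm\<^sub>w"
    and weak_boundedness: "(SUP n::nat. opnorm_on (zero_average B\<^sub>s) norm\<^sub>w (L ^^ n)) < \<infinity>"
  shows "\<exists>C\<^sub>2 \<rho>\<^sub>2 :: real. C\<^sub>2 > 0 \<and> \<rho>\<^sub>2 < 1 \<and>
    (\<forall>g\<in>zero_average B\<^sub>s. \<forall>n::nat. norm\<^sub>s ((L ^^ n) g) \<le> C\<^sub>2 * \<rho>\<^sub>2 ^ n * norm\<^sub>s g)"
proof -
  define V where "V = zero_average B\<^sub>s"
  define W where "W = zero_average B\<^sub>w"
  have V: "normed_subspace V norm\<^sub>s" and W: "normed_subspace W norm\<^sub>w"
    unfolding V_def W_def using strong_space weak_space by (simp_all add: normed_subspace_zero_average)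
  have V_sub: "cm.subspace V"
    using V by (rule normed_subspace_subspace)
  have VBs: "V \<subseteq> B\<^sub>s" and VBw: "V \<subseteq> B\<^sub>w"
    using inclusion by (auto simp: V_def zero_average_def)
  have Vw: "normed_subspace V norm\<^sub>w"
    using weak_space V_sub VBw by (rule normed_subspace_subset)
  have L_V: "L ` V \<subseteq> V"
  proof
    fix h assume "h \<in> L ` V"
    then obtain g where g: "g \<in> B\<^sub>s" "cmeasure g UNIV = 0" "h = L g"
      by (auto simp: V_def zero_average_def)
    moreover from this have "cmeasure (L g) UNIV = 0"
      using markov inclusion unfolding markov_operator_on_def by auto
    ultimately show "h \<in> V"
      using acts_strong by (auto simp: V_def zero_average_def)
  qed
  note Ln_V = funpow_image_subset[OF L_V]
  have Ln_markov: "markov_operator_on B\<^sub>w (L ^^ n)" for n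
    using markov acts_weak by (rule markov_operator_on_funpow)
  have Ln_diff: "(L ^^ n) (g - h) = (L ^^ n) g - (L ^^ n) h" if "g \<in> V" "h \<in> V" for n g h
    using markov_operator_on_diff[OF Ln_markov normed_subspace_subspace[OF weak_space]] that VBw
    by blast
  have Ln_hom: "norm\<^sub>w ((L ^^ n) (c *\<^sub>C g)) = cmod c * norm\<^sub>w ((L ^^ n) g)" if "g \<in> V" for n c g
  proof -
    have "(L ^^ n) (c *\<^sub>C g) = c *\<^sub>C (L ^^ n) g"
      using Ln_markov that VBw unfolding markov_operator_on_def by blast
    moreover have "(L ^^ n) g \<in> V"
      using Ln_V that by blast
    ultimately show ?thesis
      by (simp add: normed_subspace_norm_scale[OF Vw])
  qed
  have s_nonneg: "0 \<le> norm\<^sub>s g" if "g \<in> V" for g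
    using V that by (rule normed_subspace_norm_nonneg)
  have dominated: "norm\<^sub>w g \<le> norm\<^sub>s g" if "g \<in> V" for g
    using norm_dominance VBs that by blast
  have ly: "norm\<^sub>s ((L ^^ n) g) \<le> A * lambda\<^sub>1 ^ n * norm\<^sub>s g + B * norm\<^sub>w g" if "g \<in> V" for g n
    using lasota_yorke VBs that by blast

  obtain M :: nat where "(SUP n. opnorm_on V norm\<^sub>w (L ^^ n)) < ereal (real M)"
    using weak_boundedness less_PInf_Ex_of_nat unfolding V_def by auto
  then have M: "opnorm_on V norm\<^sub>w (L ^^ n) \<le> ereal (real M)" for n
    by (meson SUP_upper UNIV_I less_imp_le order_trans)
  have M_ball: "norm\<^sub>w ((L ^^ n) g) \<le> real M" if "g \<in> V" "norm\<^sub>w g \<le> 1" for n g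
    using M[of n] that unfolding opnorm_on_def by (simp add: SUP_le_iff)
  have weakly_bounded: "norm\<^sub>w ((L ^^ n) g) \<le> real M * norm\<^sub>w g" if "g \<in> V" for n g
    by (rule normed_subspace_bound_from_unit_ball[OF Vw, of "\<lambda>g. norm\<^sub>w ((L ^^ n) g)"])
      (use Ln_hom M_ball that in auto)

  \<comment> \<open>Each of the two terms of the two-step estimate is to take at most a quarter of
    the strong norm.\<close>
  define \<delta> where "\<delta> = 1 / (4 * (B + 1))"
  have \<delta>: "\<delta> > 0" "B * \<delta> \<le> 1 / 4"
    using constants(2) unfolding \<delta>_def by (simp_all add: field_simps)
  have "\<forall>\<^sub>F n in sequentially. \<forall>g\<in>V. norm\<^sub>s g \<le> 1 \<longrightarrow> norm\<^sub>w ((L ^^ n) g) \<le> \<delta>"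
  proof (rule uniform_decay_on_unit_ball[OF W V_sub])
    show "compactly_immersed V norm\<^sub>s W norm\<^sub>w"
      using compact_inclusion by (simp add: V_def W_def)
    show "(L ^^ n) g \<in> V" if "g \<in> V" for n g
      using Ln_V that by blast
    show "(\<lambda>n. norm\<^sub>w ((L ^^ n) g)) \<longlonglongrightarrow> 0" if "g \<in> V" for g
      using convergence that by (simp add: V_def)
  qed (use Ln_diff weakly_bounded \<delta>(1) in auto)
  then obtain n where "\<forall>g\<in>V. norm\<^sub>s g \<le> 1 \<longrightarrow> norm\<^sub>w ((L ^^ n) g) \<le> \<delta>"
    using eventually_happens'[OF sequentially_bot] by blast
  then have weak_small: "norm\<^sub>w ((L ^^ n) g) \<le> \<delta> * norm\<^sub>s g" if "g \<in> V" for g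
    by (intro normed_subspace_bound_from_unit_ball[OF V, of "\<lambda>g. norm\<^sub>w ((L ^^ n) g)"])
      (use Ln_hom that in auto)

  have "(\<lambda>m. A * (A + B) * lambda\<^sub>1 ^ m) \<longlonglongrightarrow> A * (A + B) * 0"
    using constants by (intro tendsto_intros LIMSEQ_power_zero) simp
  then have "\<forall>\<^sub>F m in sequentially. A * (A + B) * lambda\<^sub>1 ^ m < 1 / 4"
    by (rule order_tendstoD) simp
  then have "\<forall>\<^sub>F m in sequentially. A * (A + B) * lambda\<^sub>1 ^ m < 1 / 4 \<and> m > 0"
    using eventually_gt_at_top by (rule eventually_conj)
  then obtain m where m: "A * (A + B) * lambda\<^sub>1 ^ m < 1 / 4" "m > 0"
    using eventually_happens'[OF sequentially_bot] by blast

  have crude: "norm\<^sub>s ((L ^^ k) g) \<le> (A + B) * norm\<^sub>s g"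
    and two_step: "norm\<^sub>s ((L ^^ (m + n)) g)
      \<le> A * (A + B) * lambda\<^sub>1 ^ m * norm\<^sub>s g + B * norm\<^sub>w ((L ^^ n) g)"
    if "g \<in> V" for k g
    by (rule lasota_yorke_two_step[where p = norm\<^sub>s and q = norm\<^sub>w and V = V,
          OF constants(1-3) less_imp_le[OF constants(4)] s_nonneg dominated L_V ly that];
        assumption)+
  have contracting: "norm\<^sub>s ((L ^^ (m + n)) g) \<le> 1 / 2 * norm\<^sub>s g" if g: "g \<in> V" for g
  proof -
    have "A * (A + B) * lambda\<^sub>1 ^ m * norm\<^sub>s g \<le> 1 / 4 * norm\<^sub>s g"
      using m(1) s_nonneg[OF g] by (intro mult_right_mono) auto
    moreover have "B * norm\<^sub>w ((L ^^ n) g) \<le> B * (\<delta> * norm\<^sub>s g)"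
      using weak_small[OF g] constants(2) by (intro mult_left_mono)
    moreover have "B * \<delta> * norm\<^sub>s g \<le> 1 / 4 * norm\<^sub>s g"
      using \<delta>(2) s_nonneg[OF g] by (intro mult_right_mono)
    ultimately show ?thesis
      using two_step[OF g] by (simp add: mult.assoc)
  qed

  \<comment> \<open>The summand 1 keeps the final constant positive when $A = B = 0$.\<close>
  have bounded: "norm\<^sub>s ((L ^^ k) g) \<le> (A + B + 1) * norm\<^sub>s g" if g: "g \<in> V" for k g
    using crude[OF g, of k] s_nonneg[OF g] by (simp add: algebra_simps)
  obtain \<rho> where "\<rho> < 1"
    and "\<forall>g\<in>V. \<forall>k. norm\<^sub>s ((L ^^ k) g) \<le> (A + B + 1) / (1 / 2) * \<rho> ^ k * norm\<^sub>s g"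
    using exponential_decay_from_contracting_power[where p = norm\<^sub>s and L = L and V = V
        and K = "m + n" and \<theta> = "1 / 2" and D = "A + B + 1"]
      m(2) constants(1,2) s_nonneg L_V bounded contracting by auto
  moreover have "(A + B + 1) / (1 / 2) > 0"
    using constants(1,2) by simp
  ultimately show ?thesis
    unfolding V_def by blast
qed

end
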